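(* Assume that $\tau_1\neq 0$ and $$R\leq\min(2P,(I-1)^2).$$ Then the system $$\mathbf C_p=\mathbf M\mathbf D_p\mathbf M^H=\sum_{r=1}^R d_{pr}\mathbf m_r\mathbf m_r^H,\qquad p=1,\dots,P,$$ where $\mathbf M=[\mathbf m_1\ \dots\ \mathbf m_R]\in\mathbb C^{I\times R}$ and $\mathbf D_p=\operatorname{diag}(d_{p1},\dots,d_{pR})\in\mathbb C^{R\times R}$, has a unique solution for generic matrices $\mathbf M$ and $\mathbf D_1,\dots,\mathbf D_P$, i.e., $$\mu_k\{(\operatorname{vec}(\mathbf D),\operatorname{vec}(\mathbf M)):\ \text{the solution of the system is not unique}\}=0,$$ where $\mathbf D$ denotes the $P\times R$ matrix with entries $d_{pr}$, $k=IR+PR$, and $\mu_k$ is a measure that is absolutely continuous with respect to the Lebesgue measure on $\mathbb C^k$.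
   Context: The system arises in second-order blind identification. Data follow the model $\mathbf x=\mathbf M\mathbf s$, where $\mathbf x$ is the $I$-dimensional vector of observations, $\mathbf s$ is the $R$-dimensional unknown source vector and $\mathbf M$ is the $I\times R$ unknown mixing matrix; the sources are mutually uncorrelated but individually correlated in time. For lags $\tau_1,\dots,\tau_P$, $\mathbf C_p=\operatorname E(\mathbf x_t\mathbf x_{t+\tau_p}^H)$ are the spatial covariance matrices of the observations and $\mathbf D_p=\operatorname E(\mathbf s_t\mathbf s_{t+\tau_p}^H)$ is the $R\times R$ diagonal matrix with $(d_{p1},\dots,d_{pR})$ on its main diagonal. This is the variant in which the lags are nonzero ($\tau_p\neq0$, $1\leq p\leq P$), so the diagonal matrices $\mathbf D_p$ are complex. The superscript $H$ denotes the Hermitian transpose. Uniqueness. If $\mathbf M$ and $\mathbf D_1,\dots,\mathbf D_P$ satisfy the system for given $\mathbf C_1,\dots,\mathbf C_P$, then the matrices $\overline{\mathbf M}=\mathbf M\mathbf\Lambda\mathbf P$ and $\overline{\mathbf D}_1=\mathbf P^T\mathbf D_1\mathbf P,\dots,\overline{\mathbf D}_P=\mathbf P^T\mathbf D_P\mathbf P$ also satisfy it for any permutation matrix $\mathbf P$ and any diagonal unitary matrix $\mathbf\Lambda$. The system is said to have a unique solution when its solution is only subject to this trivial indeterminacy.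
   Formalization: Uniqueness is proved up to permutation, diagonal unitary factors and also positive rescaling of the columns of M (with d_pr divided by the squared scale); with unitary factors only the claim is false, since (D/4, 2M) always solves the same system. *)

theory Defs
  imports "HOL-Analysis.Analysis"
begin

definition hermitian_transpose :: "complex^'n^'m \<Rightarrow> complex^'m^'n" where
  "hermitian_transpose A = (\<chi> i j. cnj (A $ j $ i))"

definition diag_mat :: "'a::zero^'n \<Rightarrow> 'a^'n^'n" where
  "diag_mat d = (\<chi> i j. if i = j then d $ i else 0)"

definition diagonal_unitary :: "complex^'n^'n \<Rightarrow> bool" where
  "diagonal_unitary L \<longleftrightarrow> (\<forall>i j. i \<noteq> j \<longrightarrow> L $ i $ j = 0)
     \<and> L ** hermitian_transpose L = mat 1 \<and> hermitian_transpose L ** L = mat 1"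

definition permutation_matrix :: "complex^'n^'n \<Rightarrow> bool" where
  "permutation_matrix Q \<longleftrightarrow> (\<exists>\<sigma>. bij \<sigma> \<and> Q = (\<chi> i j. if i = \<sigma> j then 1 else 0))"

text \<open>
  The unknowns are a pair \<open>(D, M)\<close>, where row \<open>p\<close> of the \<open>P \<times> R\<close> matrix \<open>D\<close> is the
  diagonal of \<open>D\<^sub>p\<close> and \<open>M\<close> is the \<open>I \<times> R\<close> mixing matrix. The dimensions \<open>I, R, P\<close> are
  the cardinalities of the index types \<open>'i, 'r, 'p\<close>. All lags are
  nonzero, so the autocovariances in \<open>D\<close> range over all of \<open>\<complex>\<close>.
\<close>

type_synonym ('p, 'r, 'i) unknowns = "(complex^'r^'p) \<times> (complex^'r^'i)"

definition covariance :: "('p::finite, 'r::finite, 'i::finite) unknowns \<Rightarrow> 'p \<Rightarrow> complex^'i^'i" where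
  "covariance = (\<lambda>(D, M) p. M ** diag_mat (D $ p) ** hermitian_transpose M)"

definition solves :: "('p::finite \<Rightarrow> complex^'i^'i) \<Rightarrow> ('p::finite, 'r::finite, 'i::finite) unknowns \<Rightarrow> bool" where
  "solves C s \<longleftrightarrow> (\<forall>p. C p = covariance s p)"

definition trivially_related ::
    "('p::finite, 'r::finite, 'i::finite) unknowns \<Rightarrow> ('p, 'r, 'i) unknowns \<Rightarrow> bool" where
  "trivially_related = (\<lambda>(D, M) (D', M'). \<exists>L Q. diagonal_unitary L \<and> permutation_matrix Q
     \<and> M' = M ** L ** Q
     \<and> (\<forall>p. diag_mat (D' $ p) = transpose Q ** diag_mat (D $ p) ** Q))"

text \<open>
  Multiplying column \<open>r\<close> of \<open>M\<close> by \<open>\<delta>\<^sub>r > 0\<close> and dividing \<open>d\<^sub>p\<^sub>r\<close> by \<open>\<delta>\<^sub>r\<^sup>2\<close> for all \<open>p\<close> leaves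
  every rank-one term of the system unchanged: this is the choice of units in which source \<open>r\<close>
  is measured.
\<close>

definition rescale :: "real^'r \<Rightarrow> ('p::finite, 'r::finite, 'i::finite) unknowns \<Rightarrow> ('p, 'r, 'i) unknowns" where
  "rescale \<delta> = (\<lambda>(D, M). (\<chi> p r. D $ p $ r / of_real ((\<delta> $ r)\<^sup>2),
                          M ** diag_mat (\<chi> r. of_real (\<delta> $ r))))"

text \<open>
  Solutions are compared up to the trivial indeterminacy after the positive scales of the
  columns of \<open>M\<close> have been matched. Without matching the scales no system with a solution
  \<open>M \<noteq> 0\<close> would have a unique solution (lemma \<open>rescale_not_trivially_related\<close>); for solutions
  with normalized mixing vectors no rescaling takes place and the comparison is
  \<^const>\<open>trivially_related\<close> itself (lemma \<open>normalized_trivially_related\<close>).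
\<close>

definition unique_solution ::
    "'r::finite itself \<Rightarrow> ('p::finite \<Rightarrow> complex^'i^'i) \<Rightarrow> bool" where
  "unique_solution (_ :: 'r itself) C \<longleftrightarrow>
     (\<exists>s :: ('p, 'r, 'i) unknowns. solves C s
        \<and> (\<forall>s' :: ('p, 'r, 'i) unknowns. solves C s' \<longrightarrow>
             (\<exists>\<delta>. (\<forall>r. \<delta> $ r > 0) \<and> trivially_related s (rescale \<delta> s'))))"

lemma mult_diag_mat: "(A ** diag_mat d) $ i $ j = A $ i $ j * (d $ j :: 'a::semiring_1)"
  by (simp add: matrix_matrix_mult_def diag_mat_def if_distrib cong: if_cong)

lemma covariance_sum:
  "covariance (D, M) p = (\<Sum>r\<in>UNIV. (\<chi> i j. D $ p $ r * (M $ i $ r * cnj (M $ j $ r))))"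
  by (simp add: covariance_def vec_eq_iff matrix_matrix_mult_def[of "M ** _"] mult_diag_mat
      hermitian_transpose_def mult_ac)

lemma covariance_rescale:
  assumes "\<And>r. \<delta> $ r > 0"
  shows "covariance (rescale \<delta> (D, M)) = covariance (D, M)"
proof -
  have "\<delta> $ r \<noteq> 0" for r using assms[of r] by simp
  then show ?thesis
    by (auto simp: fun_eq_iff rescale_def covariance_sum vec_eq_iff mult_diag_mat
        power2_eq_square field_simps intro!: sum.cong)
qed

lemma trivially_relatedE:
  assumes "trivially_related (D, M) (D', M')"
  obtains \<sigma> l where "bij \<sigma>" "\<And>r. cmod (l r) = 1" 
    "\<And>i r. M' $ i $ r = M $ i $ \<sigma> r * l (\<sigma> r)"
proof -
  obtain L \<sigma> where L: "diagonal_unitary L" and \<sigma>: "bij \<sigma>"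
    and M': "M' = M ** L ** (\<chi> i j. if i = \<sigma> j then 1 else 0)"
    using assms by (auto simp: trivially_related_def permutation_matrix_def)
  define l where "l r = L $ r $ r" for r
  have Ld: "L = diag_mat (\<chi> r. l r)"
    using L by (auto simp: diagonal_unitary_def diag_mat_def vec_eq_iff l_def)
  have "l r * cnj (l r) = 1" for r
  proof -
    have "(L ** hermitian_transpose L) $ r $ r = 1"
      using L by (simp add: diagonal_unitary_def mat_def)
    then show ?thesis
      unfolding Ld by (simp add: matrix_matrix_mult_def diag_mat_def hermitian_transpose_def
          if_distrib[of cnj] if_distrib[of "(*) _"] if_distrib[of "\<lambda>x. x * _"] cong: if_cong)
  qed
  then have "cmod (l r) = 1" for r
    by (metis complex_mod_sqrt_Re_mult_cnj one_complex.simps(1) real_sqrt_one)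
  moreover have "M' $ i $ r = M $ i $ \<sigma> r * l (\<sigma> r)" for i r
    unfolding M' by (simp add: matrix_matrix_mult_def[of "M ** L"] if_distrib cong: if_cong)
      (simp add: Ld mult_diag_mat)
  ultimately show ?thesis using that \<sigma> by blast
qed

lemma rescale_not_trivially_related:
  assumes "M \<noteq> 0"
  shows "\<not> trivially_related (D, M) (rescale (\<chi> r. 2) (D, M))"
proof
  assume "trivially_related (D, M) (rescale (\<chi> r. 2) (D, M))"
  then obtain \<sigma> l where \<sigma>: "bij \<sigma>" and l: "\<And>r. cmod (l r) = 1"
    and M: "\<And>i r. (M ** diag_mat (\<chi> r. of_real ((\<chi> r. 2) $ r))) $ i $ r = M $ i $ \<sigma> r * l (\<sigma> r)"
    unfolding rescale_def prod.case by (rule trivially_relatedE) blast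
  have *: "2 * cmod (M $ i $ r) = cmod (M $ i $ \<sigma> r)" for i r
    using arg_cong[OF M[of i r], of cmod] l by (simp add: mult_diag_mat norm_mult mult.commute)
  have "(\<Sum>r\<in>UNIV. 2 * cmod (M $ i $ r)) = (\<Sum>r\<in>UNIV. cmod (M $ i $ r))" for i
    unfolding * using sum.reindex_bij_betw[OF \<sigma>, of "\<lambda>r. cmod (M $ i $ r)"] by simp
  then have "(\<Sum>r\<in>UNIV. cmod (M $ i $ r)) = 0" for i
    by (simp add: sum_distrib_left[symmetric])
  then have "M = 0" by (simp add: sum_nonneg_eq_0_iff vec_eq_iff)
  with assms show False ..
qed

lemma normalized_trivially_related:
  assumes "trivially_related (D, M) (rescale \<delta> (D', M'))"
    and \<delta>: "\<And>r. \<delta> $ r > 0"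
    and "\<And>r. norm (column r M) = 1" and "\<And>r. norm (column r M') = 1"
  shows "trivially_related (D, M) (D', M')"
proof -
  obtain \<sigma> l where l: "\<And>r. cmod (l r) = 1"
    and M: "\<And>i r. (M' ** diag_mat (\<chi> r. of_real (\<delta> $ r))) $ i $ r = M $ i $ \<sigma> r * l (\<sigma> r)"
    using assms(1) unfolding rescale_def prod.case by (rule trivially_relatedE) blast
  have "\<delta> $ r = 1" for r
  proof -
    have "\<delta> $ r *\<^sub>R column r M' = l (\<sigma> r) *s column (\<sigma> r) M"
      using M[of _ r] by (simp add: vec_eq_iff column_def mult_diag_mat
          scaleR_conv_of_real[where 'a = complex] mult.commute)
    moreover have "norm (l (\<sigma> r) *s column (\<sigma> r) M) = norm (column (\<sigma> r) M)"
      using l by (simp add: norm_vec_def norm_mult)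
    ultimately show ?thesis using assms(3,4) \<delta>[of r]
      by (metis abs_of_pos mult.right_neutral norm_scaleR)
  qed
  then have "rescale \<delta> (D', M') = (D', M')"
    by (simp add: rescale_def vec_eq_iff mult_diag_mat)
  with assms(1) show ?thesis by simp
qed

end

theory Submission
  imports Defs
begin

text \<open>
  The matrices \<open>C\<^sub>p\<close> and their Hermitian transposes are combinations of the rank-one matrices
  \<open>X\<^sub>r = m\<^sub>r m\<^sub>r\<^sup>H\<close>. For generic \<open>D\<close> the real and imaginary parts of the rows of \<open>D\<close> have full
  column rank because \<open>R \<le> 2P\<close>, so the \<open>X\<^sub>r\<close> lie in the real span of the rank-one terms \<open>X'\<^sub>s\<close> of
  any other solution; by dimension the two spans agree. It remains to see that for generic \<open>M\<close> the
  real span of the \<open>X\<^sub>r\<close> contains no \<open>x x\<^sup>H\<close> besides the multiples of the \<open>X\<^sub>r\<close>, a real form of the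
  generalized trisecant lemma.

  Suppose that \<open>x x\<^sup>H = \<Sum>\<^sub>r c\<^sub>r X\<^sub>r\<close> with two nonzero coefficients. If the columns of \<open>M\<close> are in general
  position, those with \<open>c\<^sub>r \<noteq> 0\<close> span \<open>\<complex>\<^sup>I\<close>, since otherwise they are linearly independent and the
  right-hand side has rank at least two. Hence varying \<open>M\<close> alone already moves
  \<open>\<Sum>\<^sub>r c\<^sub>r X\<^sub>r - x x\<^sup>H\<close> in all \<open>I\<^sup>2\<close> Hermitian directions. After normalizing one entry of \<open>x\<close> to 1,
  the pairs \<open>(c, x)\<close> have \<open>R + 2I - 2\<close> real degrees of freedom, and this is less than \<open>I\<^sup>2\<close> exactly
  when \<open>R \<le> (I - 1)\<^sup>2\<close>; so the solutions \<open>(M, c, x)\<close> project to a null set of matrices \<open>M\<close>.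
\<close>

section \<open>Projections of level sets\<close>

text \<open>\<open>f\<close> restricted to the orthogonal complement of its kernel already attains
  the whole range, so the range has at most the dimension of that complement.\<close>

lemma dim_kernel_add_range:
  fixes f :: "'a::euclidean_space \<Rightarrow> 'b::euclidean_space"
  assumes "linear f"
  shows "dim {x. f x = 0} + dim (range f) \<le> DIM('a)"
proof -
  define K where "K = {x. f x = 0}"
  define K' where "K' = {y \<in> UNIV. \<forall>x\<in>K. orthogonal x y}"
  have K: "subspace K"
    unfolding K_def using assms by (rule linear_subspace_kernel)
  have "range f \<subseteq> f ` K'"
  proof
    fix y assume "y \<in> range f"
    then obtain x where x: "y = f x" by blast
    obtain u v where "u \<in> span K" "\<And>w. w \<in> span K \<Longrightarrow> orthogonal v w" "x = u + v"
      using orthogonal_subspace_decomp_exists by blast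
    moreover have "u \<in> K"
      using \<open>u \<in> span K\<close> K by (metis span_eq_iff)
    ultimately have "f x = f v" "v \<in> K'"
      using linear_add[OF assms] span_base[of _ K] by (auto simp: K_def K'_def orthogonal_commute)
    with x show "y \<in> f ` K'" by blast
  qed
  then have "dim (range f) \<le> dim K'"
    by (meson assms dim_image_le dim_subset order_trans)
  moreover have "dim K' + dim K = DIM('a)"
    unfolding K'_def using dim_subspace_orthogonal_to_vectors[OF K subspace_UNIV] by simp
  ultimately show ?thesis
    unfolding K_def by linarith
qed

text \<open>A basis of \<open>K\<close> is sent bijectively onto a proper subset of
  \<open>Basis\<close>. The resulting map is faithful on \<open>K\<close>, yet its range is a
  lower-dimensional and hence null subspace.\<close>

lemma exists_singular_linear_inj_on:
  fixes K :: "'e::euclidean_space set"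
  assumes K: "subspace K" and dim: "dim K < DIM('a::euclidean_space)"
  obtains L :: "'e \<Rightarrow> 'a::euclidean_space" where "linear L" "\<forall>x\<in>K. L x = 0 \<longrightarrow> x = 0" "negligible (range L)"
proof -
  obtain B where B: "B \<subseteq> K" "independent B" "K \<subseteq> span B" "card B = dim K"
    using basis_exists by blast
  then have "finite B" using independent_imp_finite by blast
  obtain C where C: "C \<subseteq> (Basis :: 'a set)" "card C = dim K"
    using dim by (metis less_imp_le obtain_subset_with_card_n)
  have "finite C" using C finite_Basis finite_subset by blast
  obtain h where h: "bij_betw h B C"
    using \<open>finite B\<close> \<open>finite C\<close> B(4) C(2) by (metis finite_same_card_bij)
  have indC: "independent C"
    using C(1) independent_Basis independent_mono by blast
  obtain L where L: "linear L" "\<And>x. x \<in> B \<Longrightarrow> L x = h x" "range L = span (h ` B)"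
    using real_vector.linear_independent_extend_subspace[OF B(2), of h] by metis
  have LB: "L ` B = C" "inj_on L B"
    using h L(2) by (auto simp: bij_betw_def inj_on_def cong: image_cong)
  then have "inj_on L (span B)"
    using linear_inj_on_span_iff_independent_image[OF L(1)] indC by metis
  then have "x = 0" if "x \<in> K" "L x = 0" for x
    using that B(3) linear_0[OF L(1)] span_zero[of B] by (metis inj_onD subsetD)
  moreover have "dim (range L) < DIM('a)"
    using L(3) h indC C(2) dim by (simp add: bij_betw_def dim_eq_card_independent)
  ultimately show ?thesis
    using that L(1) negligible_lowdim by blast
qed

text \<open>
  A quantitative substitute for parametric transversality: near a point of \<open>Z\<close> the level set is a
  Lipschitz graph over the kernel of the derivative, whose dimension is smaller than that of \<open>'a\<close>.
\<close>

lemma negligible_fst_level_set: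
  fixes F :: "'a::euclidean_space \<times> 'b::euclidean_space \<Rightarrow> 'c::euclidean_space"
  assumes der: "\<And>z. (F has_derivative F' z) (at z)"
    and cont: "\<And>w. continuous_on UNIV (\<lambda>z. F' z w)"
    and level: "\<And>z. z \<in> Z \<Longrightarrow> F z = k"
    and dim: "\<And>z. z \<in> Z \<Longrightarrow> DIM('b) < dim (range (F' z))"
  shows "negligible (fst ` Z)"
proof -
  have bl: "bounded_linear (F' z)" for z
    using der has_derivative_bounded_linear by blast
  \<comment> \<open>Bundling the derivatives as bounded linear maps turns continuity in each
    direction into continuity in operator norm, since the domain has finite dimension.\<close>
  define G where "G z = Blinfun (F' z)" for z
  have G: "blinfun_apply (G z) = F' z" for z
    by (simp add: G_def bl bounded_linear_Blinfun_apply)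
  have contG: "continuous_on UNIV G"
    by (rule continuous_on_blinfun_componentwise) (simp add: G cont)
  have local: "\<exists>U. open U \<and> z \<in> U \<and> negligible (fst ` (Z \<inter> U))" if z: "z \<in> Z" for z
  proof -
    have lin: "linear (F' z)" using bl bounded_linear.linear by blast
    \<comment> \<open>The dimension hypothesis makes the range larger than the parameter space
      \<open>'b\<close>, so the kernel is smaller than \<open>'a\<close> and can be parametrized by
      a null set of \<open>'a\<close>.\<close>
    have dimK: "dim {x. F' z x = 0} < DIM('a)"
      using dim_kernel_add_range[OF lin] dim[OF z] by simp
    have subK: "subspace {x. F' z x = 0}"
      using lin by (rule linear_subspace_kernel)
    obtain L :: "'a \<times> 'b \<Rightarrow> 'a"
      where L: "linear L" and inj: "\<forall>x\<in>{x. F' z x = 0}. L x = 0 \<longrightarrow> x = 0"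
        and negl: "negligible (range L)"
      using exists_singular_linear_inj_on[OF subK dimK] by blast
    have linH: "linear (\<lambda>x. (F' z x, L x))"
      using lin L by (simp add: linear_iff)
    have "inj (\<lambda>x. (F' z x, L x))"
      using inj by (auto simp: linear_injective_0[OF linH] zero_prod_def)
    then obtain b where b: "b > 0" "\<And>x. b * norm x \<le> norm (F' z x, L x)"
      using linear_inj_bounded_below_pos[OF linH] by metis
    have "\<exists>d>0. \<forall>x\<in>UNIV. dist x z < d \<longrightarrow> dist (G x) (G z) < b / 2"
      using contG b(1) unfolding continuous_on_iff by (metis UNIV_I half_gt_zero)
    then obtain d where d: "d > 0" "\<And>x. dist x z < d \<Longrightarrow> dist (G x) (G z) < b / 2"
      by auto
    define U where "U = ball z d"
    \<comment> \<open>On a level set \<open>F x - F y\<close> vanishes, so on the ball, where the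
      derivative varies by at most b/2, \<open>F' z (x - y)\<close> has norm at most b/2 times that
      of \<open>x - y\<close>. The lower bound b for the pair \<open>(F' z, L)\<close> then leaves
      \<open>L\<close> to control \<open>x - y\<close>.\<close>
    have lip: "norm (x - y) \<le> 2 / b * norm (L x - L y)" if "x \<in> Z \<inter> U" "y \<in> Z \<inter> U" for x y
    proof -
      have "norm (F x - F y - F' z (x - y)) \<le> norm (x - y) * (b / 2)"
      proof (rule differentiable_bound_linearization[where S = U])
        show "y + t *\<^sub>R (x - y) \<in> U" if "t \<in> {0..1}" for t
          using convexD_alt[of U y x t] \<open>x \<in> Z \<inter> U\<close> \<open>y \<in> Z \<inter> U\<close> that
          by (simp add: U_def algebra_simps)
        show "(F has_derivative F' x) (at x within U)" for x
          using der has_derivative_at_withinI by blast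
        show "onorm (F' x - F' z) \<le> b / 2" if "x \<in> U" for x
        proof -
          have "onorm (F' x - F' z) = dist (G x) (G z)"
            by (simp add: dist_norm norm_blinfun.rep_eq minus_blinfun.rep_eq G fun_diff_def)
          also have "\<dots> \<le> b / 2"
            using d(2)[of x] that by (simp add: U_def dist_commute)
          finally show ?thesis .
        qed
      qed (use d in \<open>simp add: U_def\<close>)
      then have "norm (F' z (x - y)) \<le> norm (x - y) * (b / 2)"
        using level that by simp
      moreover have "b * norm (x - y) \<le> norm (F' z (x - y)) + norm (L (x - y))"
        using b(2)[of "x - y"] norm_Pair_le order_trans by blast
      ultimately have "b * norm (x - y) \<le> 2 * norm (L (x - y))"
        by (simp add: field_simps)
      then show ?thesis
        using b(1) linear_diff[OF L] by (simp add: field_simps)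
    qed
    define g where "g = inv_into (Z \<inter> U) L"
    have "inj_on L (Z \<inter> U)"
    proof (rule inj_onI)
      fix x y assume "x \<in> Z \<inter> U" "y \<in> Z \<inter> U" "L x = L y"
      then show "x = y" using lip[of x y] by simp
    qed
    then have g: "g (L x) = x" if "x \<in> Z \<inter> U" for x
      using that by (simp add: g_def)
    \<comment> \<open>\<open>L\<close> maps the local piece of \<open>Z\<close> into a null set, and
      \<open>g\<close> recovers the piece from there in a Lipschitz way.\<close>
    have "negligible ((fst \<circ> g) ` (L ` (Z \<inter> U)))"
    proof (rule negligible_locally_Lipschitz_image)
      show "negligible (L ` (Z \<inter> U))"
        using negl by (rule negligible_subset) blast
      fix u assume u: "u \<in> L ` (Z \<inter> U)"
      have "norm ((fst \<circ> g) v - (fst \<circ> g) u) \<le> 2 / b * norm (v - u)" if v: "v \<in> L ` (Z \<inter> U)" for v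
      proof -
        have "norm (fst (g v) - fst (g u)) \<le> norm (g v - g u)"
          by (simp add: minus_prod_def norm_fst_le)
        also have "\<dots> \<le> 2 / b * norm (v - u)"
          using u v by (metis (no_types, lifting) g imageE lip)
        finally show ?thesis by simp
      qed
      then show "\<exists>T B. open T \<and> u \<in> T \<and> (\<forall>v\<in>L ` (Z \<inter> U) \<inter> T.
          norm ((fst \<circ> g) v - (fst \<circ> g) u) \<le> B * norm (v - u))"
        by (intro exI[of _ UNIV] exI[of _ "2 / b"]) auto
    qed simp
    moreover have "(fst \<circ> g) ` (L ` (Z \<inter> U)) = fst ` (Z \<inter> U)"
      unfolding image_comp by (rule image_cong[OF refl]) (simp only: o_apply g)
    ultimately show ?thesis
      using d(1) by (intro exI[of _ U]) (auto simp: U_def)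
  qed
  \<comment> \<open>Countably many of the local neighbourhoods cover \<open>Z\<close>, so the null
    sets can be united.\<close>
  define \<U> where "\<U> = {U. open U \<and> negligible (fst ` (Z \<inter> U))}"
  obtain \<V> where \<V>: "\<V> \<subseteq> \<U>" "countable \<V>" "\<Union>\<V> = \<Union>\<U>"
    using Lindelof[of \<U>] by (auto simp: \<U>_def)
  have "Z \<subseteq> \<Union>\<V>"
    unfolding \<V>(3) \<U>_def using local by blast
  then have "fst ` Z \<subseteq> \<Union>((\<lambda>U. fst ` (Z \<inter> U)) ` \<V>)"
    by blast
  moreover have "negligible (\<Union>((\<lambda>U. fst ` (Z \<inter> U)) ` \<V>))"
    using \<V> by (intro negligible_countable_Union) (auto simp: \<U>_def)
  ultimately show ?thesis
    by (rule negligible_subset[rotated])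
qed

section \<open>Cylinders over null sets\<close>

text \<open>A Lebesgue null set is first enlarged to a Borel null set, to which the rule for product
  measures applies.\<close>

lemma negligible_Times_UNIV:
  fixes S :: "'a::euclidean_space set"
  assumes "negligible S"
  shows "negligible (S \<times> (UNIV :: 'b::euclidean_space set))"
proof -
  obtain N where N: "N \<in> null_sets lborel" "S \<subseteq> N"
    using assms unfolding negligible_iff_null_sets null_sets_completion_iff2 by blast
  have "N \<times> (UNIV :: 'b set) \<in> null_sets (lborel \<Otimes>\<^sub>M lborel)"
    using N(1) by (intro lborel.times_in_null_sets1) auto
  then have "N \<times> (UNIV :: 'b set) \<in> null_sets lborel"
    by (simp add: lborel_prod)
  then show ?thesis
    using N(2) null_sets_completionI null_sets_completion_subset Sigma_mono
    unfolding negligible_iff_null_sets by (metis order_refl)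
qed

lemma negligible_UNIV_Times:
  fixes S :: "'a::euclidean_space set"
  assumes "negligible S"
  shows "negligible ((UNIV :: 'b::euclidean_space set) \<times> S)"
proof -
  obtain N where N: "N \<in> null_sets lborel" "S \<subseteq> N"
    using assms unfolding negligible_iff_null_sets null_sets_completion_iff2 by blast
  have "(UNIV :: 'b set) \<times> N \<in> null_sets (lborel \<Otimes>\<^sub>M lborel)"
    using N(1) by (intro lborel.times_in_null_sets2) auto
  then have "(UNIV :: 'b set) \<times> N \<in> null_sets lborel"
    by (simp add: lborel_prod)
  then show ?thesis
    using N(2) null_sets_completionI null_sets_completion_subset Sigma_mono
    unfolding negligible_iff_null_sets by (metis order_refl)
qed

section \<open>Generic matrices\<close>

text \<open>Lets the maps below, whose values are vectors and matrices, be differentiated entry by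
  entry.\<close>

lemma has_derivative_vec_lambda [derivative_intros]:
  fixes f :: "'a::real_normed_vector \<Rightarrow> 'n::finite \<Rightarrow> 'b::euclidean_space"
  assumes "\<And>i. ((\<lambda>x. f x i) has_derivative (\<lambda>h. f' h i)) (at x)"
  shows "((\<lambda>x. \<chi> i. f x i) has_derivative (\<lambda>h. \<chi> i. f' h i)) (at x)"
  using assms
  by (auto simp: has_derivative_componentwise_within[where f = "\<lambda>x. \<chi> i. f x i"]
      has_derivative_componentwise_within[where f = "\<lambda>x. f x _"] Basis_vec_def inner_axis)

lemmas vec_nth_has_derivative [derivative_intros] =
  bounded_linear.has_derivative[OF bounded_linear_vec_nth]

lemma dim_range_surj:
  fixes f :: "'a::euclidean_space \<Rightarrow> 'b::euclidean_space"
  assumes "\<And>y. \<exists>x. f x = y"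
  shows "dim (range f) = DIM('b)"
  using assms by (metis dim_UNIV surjI)

section \<open>Real independence of the columns of a generic \<open>D\<close>\<close>

definition real_independent_columns :: "complex^'r^'p \<Rightarrow> bool" where
  "real_independent_columns D \<longleftrightarrow> (\<forall>c :: 'r \<Rightarrow> real.
     (\<forall>p. (\<Sum>r\<in>UNIV. of_real (c r) * D $ p $ r) = 0) \<longrightarrow> (\<forall>r. c r = 0))"

text \<open>A nontrivial relation can be scaled to have one coefficient 1, so finitely many level
  sets cover the bad matrices. Relation and normalization impose 2P + 1 real conditions, more than
  the R real parameters in \<open>c\<close>.\<close>

lemma negligible_not_real_independent_columns:
  assumes "CARD('r::finite) \<le> 2 * CARD('p::finite)"
  shows "negligible {D :: complex^'r^'p. \<not> real_independent_columns D}"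
proof -
  have "negligible (fst ` {(D :: complex^'r^'p, c :: real^'r).
    c $ s = 1 \<and> (\<forall>p. (\<Sum>r\<in>UNIV. of_real (c $ r) * D $ p $ r) = 0)})" (is "negligible (fst ` ?Z)") for s
  proof (rule negligible_fst_level_set)
    define F :: "(complex^'r^'p) \<times> (real^'r) \<Rightarrow> (complex^'p) \<times> real" where
      "F z = ((\<chi> p. \<Sum>r\<in>UNIV. of_real (snd z $ r) * fst z $ p $ r), snd z $ s)" for z
    define F' :: "(complex^'r^'p) \<times> (real^'r) \<Rightarrow> (complex^'r^'p) \<times> (real^'r) \<Rightarrow> (complex^'p) \<times> real"
      where "F' z h = ((\<chi> p. \<Sum>r\<in>UNIV. of_real (snd z $ r) * fst h $ p $ r
        + of_real (snd h $ r) * fst z $ p $ r), snd h $ s)" for z h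
    show "(F has_derivative F' z) (at z)" for z
      unfolding F_def F'_def by (auto intro!: derivative_eq_intros)
    show "continuous_on UNIV (\<lambda>z. F' z h)" for h
      unfolding F'_def by (intro continuous_intros)
    show "F z = (0, 1)" if "z \<in> ?Z" for z
      using that by (auto simp: F_def vec_eq_iff)
    show "DIM(real^'r) < dim (range (F' z))" if z_in: "z \<in> ?Z" for z
    proof -
      obtain D c where z: "z = (D, c)" "c $ s = 1" "\<And>p. (\<Sum>r\<in>UNIV. of_real (c $ r) * D $ p $ r) = 0"
        using z_in by blast
      have "\<exists>h. F' z h = y" for y
      proof -
        obtain u t where y: "y = (u, t)" by (cases y)
        \<comment> \<open>Moving only column \<open>s\<close> of \<open>D\<close>, whose coefficient
          is 1, yields any \<open>u\<close>. Moving \<open>c\<close> along itself preserves the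
          relation and changes the normalized coefficient by \<open>t\<close>.\<close>
        have "(\<Sum>r\<in>UNIV. of_real (c $ r) * (if r = s then u $ p else 0)) = u $ p" for p
          by (simp add: z(2) if_distrib cong: if_cong)
        moreover have "(\<Sum>r\<in>UNIV. of_real (t * c $ r) * D $ p $ r) = 0" for p
          using z(3)[of p] by (simp add: mult.assoc flip: sum_distrib_left)
        ultimately have "F' z ((\<chi> p r. if r = s then u $ p else 0), t *\<^sub>R c) = y"
          using z by (simp add: F'_def y sum.distrib vec_eq_iff del: of_real_mult)
        then show ?thesis ..
      qed
      then show ?thesis
        using assms by (subst dim_range_surj) auto
    qed
  qed
  then have "negligible (\<Union>s. fst ` {(D :: complex^'r^'p, c :: real^'r).
    c $ s = 1 \<and> (\<forall>p. (\<Sum>r\<in>UNIV. of_real (c $ r) * D $ p $ r) = 0)})"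
    by (intro negligible_Union) auto
  then show ?thesis
  proof (rule negligible_subset, safe)
    fix D :: "complex^'r^'p"
    assume "\<not> real_independent_columns D"
    then obtain c :: "'r \<Rightarrow> real" and s
      where "c s \<noteq> 0" and c: "\<forall>p. (\<Sum>r\<in>UNIV. of_real (c r) * D $ p $ r) = 0"
      unfolding real_independent_columns_def by blast
    have "(\<Sum>r\<in>UNIV. of_real (c r / c s) * D $ p $ r) = 0" for p
      using c by (simp flip: sum_divide_distrib)
    then have "(D, \<chi> r. c r / c s) \<in> {(D, c). c $ s = 1
      \<and> (\<forall>p. (\<Sum>r\<in>UNIV. of_real (c $ r) * D $ p $ r) = 0)}"
      using \<open>c s \<noteq> 0\<close> by simp
    then show "D \<in> (\<Union>s. fst ` {(D, c). c $ s = 1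
      \<and> (\<forall>p. (\<Sum>r\<in>UNIV. of_real (c $ r) * D $ p $ r) = 0)})"
      by (metis (no_types, lifting) UNIV_I UN_I fst_conv imageI)
  qed
qed

section \<open>Columns of a generic \<open>M\<close> in general position\<close>

text \<open>
  For injective \<open>f\<close> this says that the columns selected by \<open>f\<close> are linearly independent.
  Arbitrary \<open>f\<close> are allowed in order to cover the case of fewer than \<open>CARD('i)\<close> columns.
\<close>

definition general_position :: "complex^'r^'i \<Rightarrow> bool" where
  "general_position M \<longleftrightarrow> (\<forall>(f :: 'i \<Rightarrow> 'r) (a :: 'i \<Rightarrow> complex) s.
     (\<forall>i. (\<Sum>j\<in>UNIV. a j * M $ i $ f j) = 0) \<longrightarrow> (\<Sum>j | f j = s. a j) = 0)"

text \<open>There is one level set for each pair \<open>(f, s)\<close>, with the nonzero fibre sum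
  scaled to 1. The coefficients have 2I real parameters against 2I + 2 real conditions.\<close>

lemma negligible_not_general_position:
  "negligible {M :: complex^'r::finite^'i::finite. \<not> general_position M}"
proof -
  define Z where "Z f s = {(M :: complex^'r^'i, a :: complex^'i).
    (\<forall>i. (\<Sum>j\<in>UNIV. a $ j * M $ i $ f j) = 0) \<and> (\<Sum>j | f j = s. a $ j) = 1}" for f s
  have "negligible (fst ` Z f s)" for f s
  proof (rule negligible_fst_level_set)
    define F :: "(complex^'r^'i) \<times> (complex^'i) \<Rightarrow> (complex^'i) \<times> complex" where
      "F z = ((\<chi> i. \<Sum>j\<in>UNIV. snd z $ j * fst z $ i $ f j), \<Sum>j | f j = s. snd z $ j)" for z
    define F' :: "(complex^'r^'i) \<times> (complex^'i) \<Rightarrow> (complex^'r^'i) \<times> (complex^'i) \<Rightarrow> (complex^'i) \<times> complex"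
      where "F' z h = ((\<chi> i. \<Sum>j\<in>UNIV. snd z $ j * fst h $ i $ f j
        + snd h $ j * fst z $ i $ f j), \<Sum>j | f j = s. snd h $ j)" for z h
    show "(F has_derivative F' z) (at z)" for z
      unfolding F_def F'_def by (auto intro!: derivative_eq_intros)
    show "continuous_on UNIV (\<lambda>z. F' z h)" for h
      unfolding F'_def by (intro continuous_intros)
    show "F z = (0, 1)" if "z \<in> Z f s" for z
      using that by (auto simp: F_def Z_def vec_eq_iff)
    show "DIM(complex^'i) < dim (range (F' z))" if z_in: "z \<in> Z f s" for z
    proof -
      obtain M a where z: "z = (M, a)" "\<And>i. (\<Sum>j\<in>UNIV. a $ j * M $ i $ f j) = 0"
          "(\<Sum>j | f j = s. a $ j) = 1"
        using z_in unfolding Z_def by blast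
      have "\<exists>h. F' z h = y" for y
      proof -
        obtain u t where y: "y = (u, t)" by (cases y)
        \<comment> \<open>Moving only column \<open>s\<close> of \<open>M\<close> by
          \<open>u\<close> works because the fibre sum is 1; moving \<open>a\<close> along itself
          preserves the relation and adjusts the fibre sum.\<close>
        have "(\<Sum>j\<in>UNIV. a $ j * (if f j = s then u $ i else 0)) = (\<Sum>j | f j = s. a $ j) * u $ i" for i
          by (simp add: sum_distrib_right sum.If_cases if_distrib Int_def cong: if_cong)
        moreover have "(\<Sum>j\<in>UNIV. t * a $ j * M $ i $ f j) = 0" for i
          using z(2)[of i] by (simp add: mult.assoc flip: sum_distrib_left)
        ultimately have "F' z ((\<chi> i r. if r = s then u $ i else 0), t *s a) = y"
          using z by (simp add: F'_def y sum.distrib vec_eq_iff flip: sum_distrib_left)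
        then show ?thesis ..
      qed
      then show ?thesis
        by (subst dim_range_surj) auto
    qed
  qed
  then have "negligible (\<Union>(f, s)\<in>UNIV. fst ` Z f s)"
    by (intro negligible_Union) auto
  then show ?thesis
  proof (rule negligible_subset, safe)
    fix M :: "complex^'r^'i"
    assume "\<not> general_position M"
    then obtain f :: "'i \<Rightarrow> 'r" and a :: "'i \<Rightarrow> complex" and s
      where a: "\<And>i. (\<Sum>j\<in>UNIV. a j * M $ i $ f j) = 0" "(\<Sum>j | f j = s. a j) \<noteq> 0"
      unfolding general_position_def by blast
    define t where "t = (\<Sum>j | f j = s. a j)"
    have "(\<Sum>j\<in>UNIV. a j / t * M $ i $ f j) = 0" for i
      using a(1)[of i] by (simp flip: sum_divide_distrib)
    moreover have "(\<Sum>j | f j = s. a j / t) = 1"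
      using a(2) by (simp add: t_def flip: sum_divide_distrib)
    ultimately have "(M, \<chi> j. a j / t) \<in> Z f s"
      by (simp add: Z_def)
    then show "M \<in> (\<Union>(f, s)\<in>UNIV. fst ` Z f s)"
      by force
  qed
qed

text \<open>\<open>S\<close> is indexed by a set of row indices, and the remaining indices get
  coefficient 0. The fibre over \<open>r\<close> then contributes \<open>b r\<close> alone.\<close>

lemma general_position_independent:
  fixes M :: "complex^'r::finite^'i::finite"
  assumes "general_position M" and card: "card S \<le> CARD('i)"
    and sum: "\<And>i. (\<Sum>r\<in>S. b r * M $ i $ r) = 0" and "r \<in> S"
  shows "b r = 0"
proof -
  obtain T :: "'i set" where "card T = card S"
    using card by (metis obtain_subset_with_card_n)
  then obtain g where g: "bij_betw g T S"
    using finite_same_card_bij[of T S] by auto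
  define a where "a j = (if j \<in> T then b (g j) else 0)" for j
  have "(\<Sum>j\<in>UNIV. a j * M $ i $ g j) = 0" for i
  proof -
    have "(\<Sum>j\<in>UNIV. a j * M $ i $ g j) = (\<Sum>j\<in>T. b (g j) * M $ i $ g j)"
      by (rule sum.mono_neutral_cong_right) (auto simp: a_def)
    then show ?thesis
      using sum.reindex_bij_betw[OF g, of "\<lambda>r. b r * M $ i $ r"] sum by simp
  qed
  then have "(\<Sum>j | g j = r. a j) = 0"
    using assms(1) unfolding general_position_def by blast
  moreover have "(\<Sum>j | g j = r. a j) = (\<Sum>j \<in> {j\<in>T. g j = r}. b r)"
    by (rule sum.mono_neutral_cong_right) (auto simp: a_def)
  moreover obtain k where "k \<in> T" "g k = r"
    using g \<open>r \<in> S\<close> by (auto simp: bij_betw_def)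
  then have "{j\<in>T. g j = r} = {k}"
    using g by (auto simp: bij_betw_def inj_on_def)
  ultimately show ?thesis by simp
qed

text \<open>A square block of columns from \<open>S\<close> is invertible; its inverse, padded with
  zero rows, is \<open>N\<close>. The support condition later permits division by coefficients that
  are nonzero only on \<open>S\<close>.\<close>

lemma general_position_right_inverse:
  fixes M :: "complex^'r::finite^'i::finite"
  assumes "general_position M" and card: "CARD('i) \<le> card S"
  shows "\<exists>N. (\<forall>r j. r \<notin> S \<longrightarrow> N r j = 0)
    \<and> (\<forall>i j. (\<Sum>r\<in>UNIV. M $ i $ r * N r j) = (if i = j then 1 else 0))"
proof -
  obtain T where T: "T \<subseteq> S" "card T = CARD('i)"
    using card by (metis obtain_subset_with_card_n)
  then obtain g where g: "bij_betw g (UNIV :: 'i set) T"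
    using finite_same_card_bij[of "UNIV :: 'i set" T] by auto
  define A :: "complex^'i^'i" where "A = (\<chi> i j. M $ i $ g j)"
  have "v = 0" if "A *v v = 0" for v
  proof -
    have "(\<Sum>j\<in>UNIV. v $ j * M $ i $ g j) = 0" for i
      using that by (simp add: A_def matrix_vector_mult_def vec_eq_iff mult.commute)
    then have *: "(\<Sum>j | g j = s. v $ j) = 0" for s
      using assms(1) unfolding general_position_def by blast
    have "{j. g j = g i} = {i}" for i
      using g by (auto simp: bij_betw_def inj_on_def)
    then show ?thesis
      using *[of "g _"] by (simp add: vec_eq_iff)
  qed
  then obtain B where "B ** A = mat 1"
    using matrix_left_invertible_ker by blast
  then have AB: "A ** B = mat 1"
    by (simp add: matrix_left_right_inverse)
  define N where "N r j = (if r \<in> T then B $ inv_into UNIV g r $ j else 0)" for r j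
  have "(\<Sum>r\<in>UNIV. M $ i $ r * N r j) = (if i = j then 1 else 0)" for i j
  proof -
    have "(\<Sum>r\<in>UNIV. M $ i $ r * N r j) = (\<Sum>r\<in>T. M $ i $ r * B $ inv_into UNIV g r $ j)"
      by (rule sum.mono_neutral_cong_right) (auto simp: N_def)
    also have "\<dots> = (\<Sum>k\<in>UNIV. M $ i $ g k * B $ k $ j)"
      using g by (subst sum.reindex_bij_betw[OF g, symmetric]) (simp add: bij_betw_def)
    also have "\<dots> = (A ** B) $ i $ j"
      by (simp add: A_def matrix_matrix_mult_def)
    finally show ?thesis by (simp add: AB mat_def)
  qed
  moreover have "N r j = 0" if "r \<notin> S" for r j
    using that T(1) by (auto simp: N_def)
  ultimately show ?thesis by blast
qed

section \<open>Rank-one matrices in the span of generic rank-one terms\<close>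

lemma sum_cnj_mult_self_eq_0_iff:
  fixes v :: "'i::finite \<Rightarrow> complex"
  shows "(\<Sum>i\<in>UNIV. cnj (v i) * v i) = 0 \<longleftrightarrow> (\<forall>i. v i = 0)"
proof -
  have "(\<Sum>i\<in>UNIV. cnj (v i) * v i) = of_real (\<Sum>i\<in>UNIV. (cmod (v i))\<^sup>2)"
    by (simp add: complex_norm_square mult.commute del: of_real_power)
  also have "\<dots> = 0 \<longleftrightarrow> (\<forall>i. v i = 0)"
    by (simp only: of_real_eq_0_iff) (simp add: sum_nonneg_eq_0_iff)
  finally show ?thesis .
qed

text \<open>
  If at most \<open>CARD('i)\<close> coefficients were nonzero, the combination would have rank at least two.
\<close>

lemma rank_one_combination_support:
  fixes M :: "complex^'r::finite^'i::finite" and x :: "'i \<Rightarrow> complex"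
  assumes gp: "general_position M" and x: "x i0 \<noteq> 0"
    and eq: "\<And>i j. (\<Sum>r\<in>UNIV. c r * (M $ i $ r * cnj (M $ j $ r))) = x i * cnj (x j)"
    and st: "s \<noteq> t" "c s \<noteq> 0" "c t \<noteq> 0"
  shows "CARD('i) \<le> card {r. c r \<noteq> 0}"
proof (rule ccontr)
  define S where "S = {r. c r \<noteq> 0}"
  assume "\<not> ?thesis"
  then have card: "card S \<le> CARD('i)" by (simp add: S_def)
  note indep = general_position_independent[OF gp card]
  define X where "X = (\<Sum>j\<in>UNIV. cnj (x j) * x j)"
  have "X \<noteq> 0"
    unfolding X_def sum_cnj_mult_self_eq_0_iff using x by blast
  define \<alpha> where "\<alpha> r = (\<Sum>j\<in>UNIV. cnj (x j) * M $ j $ r)" for r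
  \<comment> \<open>Up to the factor \<open>X\<close>, \<open>h\<close> is the part of column
    \<open>r\<close> orthogonal to \<open>x\<close>. Applying both sides of \<open>eq\<close> to
    \<open>h\<close> gives 0, so independence makes \<open>h\<close> orthogonal to column
    \<open>r\<close> as well, hence to itself.\<close>
  have parallel: "X * M $ i $ r = \<alpha> r * x i" if r: "r \<in> S" for r i
  proof -
    define h where "h j = X * M $ j $ r - \<alpha> r * x j" for j
    have xh: "(\<Sum>j\<in>UNIV. cnj (x j) * h j) = 0"
    proof -
      have "cnj (x j) * h j = X * (cnj (x j) * M $ j $ r) - \<alpha> r * (cnj (x j) * x j)" for j
        by (simp add: h_def algebra_simps)
      then have "(\<Sum>j\<in>UNIV. cnj (x j) * h j) = X * \<alpha> r - \<alpha> r * X"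
        by (simp add: sum_subtractf X_def \<alpha>_def sum_distrib_left)
      then show ?thesis by simp
    qed
    have "(\<Sum>q\<in>S. c q * (\<Sum>j\<in>UNIV. cnj (M $ j $ q) * h j) * M $ i $ q) = 0" for i
    proof -
      have "(\<Sum>q\<in>S. c q * (\<Sum>j\<in>UNIV. cnj (M $ j $ q) * h j) * M $ i $ q)
          = (\<Sum>q\<in>UNIV. \<Sum>j\<in>UNIV. c q * (M $ i $ q * cnj (M $ j $ q)) * h j)"
        by (rule sum.mono_neutral_cong_left)
          (auto simp: S_def sum_distrib_left sum_distrib_right mult_ac)
      also have "\<dots> = (\<Sum>j\<in>UNIV. x i * cnj (x j) * h j)"
        by (subst sum.swap) (simp add: eq flip: sum_distrib_right)
      also have "\<dots> = 0"
        using xh by (simp add: mult.assoc flip: sum_distrib_left)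
      finally show ?thesis .
    qed
    then have "c r * (\<Sum>j\<in>UNIV. cnj (M $ j $ r) * h j) = 0"
      using r by (rule indep)
    then have mh: "(\<Sum>j\<in>UNIV. cnj (M $ j $ r) * h j) = 0"
      using r by (simp add: S_def)
    have "(\<Sum>j\<in>UNIV. cnj (h j) * h j) = cnj X * (\<Sum>j\<in>UNIV. cnj (M $ j $ r) * h j)
        - cnj (\<alpha> r) * (\<Sum>j\<in>UNIV. cnj (x j) * h j)"
      by (simp add: h_def[of _] left_diff_distrib sum_subtractf sum_distrib_left mult.assoc)
    then have "h i = 0"
      using mh xh sum_cnj_mult_self_eq_0_iff[of h] by simp
    then show ?thesis by (simp add: h_def)
  qed
  have sS: "s \<in> S" and tS: "t \<in> S" using st by (auto simp: S_def)
  have "\<alpha> s = 0"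
  proof -
    \<comment> \<open>Columns \<open>s\<close> and \<open>t\<close> are both parallel to
      \<open>x\<close>, so these coefficients cancel them. Independence then makes column
      \<open>s\<close> orthogonal as well as parallel to \<open>x\<close>, that is, zero.\<close>
    define b where "b r = (if r = s then \<alpha> t else if r = t then - \<alpha> s else 0)" for r
    have "(\<Sum>r\<in>S. b r * M $ i $ r) = 0" for i
    proof -
      have "(\<Sum>r\<in>S. b r * M $ i $ r) = (\<Sum>r\<in>{s, t}. b r * M $ i $ r)"
        using sS tS by (intro sum.mono_neutral_right) (auto simp: b_def)
      also have "\<dots> = \<alpha> t * M $ i $ s - \<alpha> s * M $ i $ t"
        using st(1) by (simp add: b_def)
      finally have *: "(\<Sum>r\<in>S. b r * M $ i $ r) = \<alpha> t * M $ i $ s - \<alpha> s * M $ i $ t" .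
      have "X * (\<Sum>r\<in>S. b r * M $ i $ r) = \<alpha> t * (X * M $ i $ s) - \<alpha> s * (X * M $ i $ t)"
        unfolding * by (simp add: algebra_simps)
      then show ?thesis
        using \<open>X \<noteq> 0\<close> by (simp add: parallel sS tS)
    qed
    then have "b t = 0" using tS by (rule indep)
    then show ?thesis using st(1) by (simp add: b_def)
  qed
  then have Ms: "M $ i $ s = 0" for i
    using parallel[OF sS, of i] \<open>X \<noteq> 0\<close> by simp
  have "(\<Sum>r\<in>S. (if r = s then 1 else 0) * M $ i $ r) = 0" for i
    by (rule sum.neutral) (auto simp: Ms)
  from indep[OF this sS] show False by simp
qed

text \<open>Identifies the Hermitian matrices with a real vector space whose dimension is evident.\<close>

definition hermitian_param :: "real^'i^'i \<Rightarrow> complex^'i^'i" where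
  "hermitian_param A = (\<chi> i j. Complex (A $ i $ j + A $ j $ i) (A $ i $ j - A $ j $ i))"

lemma linear_hermitian_param: "linear hermitian_param"
  by (rule linearI) (auto simp: hermitian_param_def vec_eq_iff complex_eq_iff algebra_simps)

lemma inj_hermitian_param: "inj hermitian_param"
proof (rule injI)
  fix A B :: "real^'i^'i"
  assume *: "hermitian_param A = hermitian_param B"
  have "A $ i $ j = B $ i $ j" for i j
  proof -
    have "hermitian_param A $ i $ j = hermitian_param B $ i $ j"
      using * by simp
    then show ?thesis by (simp add: hermitian_param_def)
  qed
  then show "A = B" by (simp add: vec_eq_iff)
qed

lemma cnj_hermitian_param: "cnj (hermitian_param A $ i $ j) = hermitian_param A $ j $ i"
  by (simp add: hermitian_param_def complex_eq_iff)

text \<open>The condition restricts the coefficients and not merely the matrix they produce. It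
  therefore also excludes linear relations among the terms when no column of \<open>M\<close> is
  zero.\<close>

definition no_further_rank_one :: "complex^'r^'i \<Rightarrow> bool" where
  "no_further_rank_one M \<longleftrightarrow> (\<forall>(c :: 'r \<Rightarrow> real) x s t. x \<noteq> (\<lambda>i. 0)
     \<longrightarrow> (\<forall>i j. (\<Sum>r\<in>UNIV. of_real (c r) * (M $ i $ r * cnj (M $ j $ r))) = x i * cnj (x j))
     \<longrightarrow> c s \<noteq> 0 \<longrightarrow> c t \<noteq> 0 \<longrightarrow> s = t)"

text \<open>Normalizing \<open>x $ i0\<close> to 1 gives a level set with R + 2I real parameters in
  \<open>(c, x)\<close>. The range of the derivative has dimension at least I * I + 2: all Hermitian
  matrices and the normalized entry. The bound on R makes the first number smaller.\<close>

lemma negligible_further_rank_one: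
  assumes "CARD('r::finite) \<le> (CARD('i::finite) - 1)\<^sup>2"
  shows "negligible {M :: complex^'r^'i. general_position M \<and> \<not> no_further_rank_one M}"
proof -
  define Z where "Z i0 = {(M :: complex^'r^'i, c :: real^'r, x :: complex^'i). general_position M
    \<and> x $ i0 = 1
    \<and> (\<forall>i j. (\<Sum>r\<in>UNIV. of_real (c $ r) * (M $ i $ r * cnj (M $ j $ r))) = x $ i * cnj (x $ j))
    \<and> (\<exists>s t. s \<noteq> t \<and> c $ s \<noteq> 0 \<and> c $ t \<noteq> 0)}" for i0
  have "negligible (fst ` Z i0)" for i0
  proof (rule negligible_fst_level_set)
    define F :: "(complex^'r^'i) \<times> (real^'r) \<times> (complex^'i) \<Rightarrow> (complex^'i^'i) \<times> complex" where
      "F z = ((\<chi> i j. (\<Sum>r\<in>UNIV. of_real (fst (snd z) $ r) * (fst z $ i $ r * cnj (fst z $ j $ r)))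
        - snd (snd z) $ i * cnj (snd (snd z) $ j)), snd (snd z) $ i0)" for z
    define F' :: "(complex^'r^'i) \<times> (real^'r) \<times> (complex^'i) \<Rightarrow>
        (complex^'r^'i) \<times> (real^'r) \<times> (complex^'i) \<Rightarrow> (complex^'i^'i) \<times> complex" where
      "F' z h = ((\<chi> i j. (\<Sum>r\<in>UNIV.
          of_real (fst (snd z) $ r) * (fst z $ i $ r * cnj (fst h $ j $ r) + fst h $ i $ r * cnj (fst z $ j $ r))
          + of_real (fst (snd h) $ r) * (fst z $ i $ r * cnj (fst z $ j $ r)))
        - (snd (snd z) $ i * cnj (snd (snd h) $ j) + snd (snd h) $ i * cnj (snd (snd z) $ j))),
        snd (snd h) $ i0)" for z h
    show "(F has_derivative F' z) (at z)" for z
      unfolding F_def F'_def by (auto intro!: derivative_eq_intros)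
    show "continuous_on UNIV (\<lambda>z. F' z h)" for h
      unfolding F'_def by (intro continuous_intros)
    show "F z = (0, 1)" if "z \<in> Z i0" for z
      using that by (auto simp: F_def Z_def vec_eq_iff)
    show "DIM((real^'r) \<times> (complex^'i)) < dim (range (F' z))" if z_in: "z \<in> Z i0" for z
    proof -
      obtain M c x s t where z: "z = (M, c, x)" and gp: "general_position M" and x: "x $ i0 = 1"
        and eq: "\<And>i j. (\<Sum>r\<in>UNIV. of_real (c $ r) * (M $ i $ r * cnj (M $ j $ r))) = x $ i * cnj (x $ j)"
        and st: "s \<noteq> t" "c $ s \<noteq> 0" "c $ t \<noteq> 0"
        using z_in unfolding Z_def by blast
      have card: "CARD('i) \<le> card {r. complex_of_real (c $ r) \<noteq> 0}"
        using rank_one_combination_support[OF gp _ eq st(1), of i0] x st by simp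
      obtain N where N: "\<And>r j. r \<notin> {r. complex_of_real (c $ r) \<noteq> 0} \<Longrightarrow> N r j = 0"
        "\<And>i j. (\<Sum>r\<in>UNIV. M $ i $ r * N r j) = (if i = j then 1 else 0)"
        using general_position_right_inverse[OF gp card] by blast
      define \<Psi> :: "(real^'i^'i) \<times> complex \<Rightarrow> (complex^'i^'i) \<times> complex"
        where "\<Psi> y = (hermitian_param (fst y), snd y)" for y
      have "\<Psi> (A, w) \<in> range (F' z)" for A w
      proof -
        define H where "H = hermitian_param A"
        \<comment> \<open>Solves
          \<open>of_real (c $ r) * dM $ i $ r = (H * N^H) $ i $ r / 2\<close>; as \<open>N\<close>
          is a right inverse of \<open>M\<close>, each of the two conjugate terms of the derivative
          contributes half of \<open>H\<close>. Where \<open>c $ r = 0\<close>, row \<open>r\<close>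
          of \<open>N\<close> is zero and nothing is lost.\<close>
        define dM where "dM = (\<chi> i r. (\<Sum>k\<in>UNIV. H $ i $ k * cnj (N r k)) / (2 * of_real (c $ r)))"
        have half: "(\<Sum>r\<in>UNIV. of_real (c $ r) * (dM $ i $ r * cnj (M $ j $ r))) = H $ i $ j / 2" for i j
        proof -
          have "of_real (c $ r) * dM $ i $ r = (\<Sum>k\<in>UNIV. H $ i $ k * cnj (N r k)) / 2" for r
            using N(1)[of r] by (cases "c $ r = 0") (simp_all add: dM_def)
          then have "of_real (c $ r) * (dM $ i $ r * cnj (M $ j $ r))
              = (\<Sum>k\<in>UNIV. H $ i $ k * cnj (M $ j $ r * N r k)) / 2" for r
            by (simp only: mult.assoc[symmetric]) (simp add: sum_distrib_left mult_ac)
          then have "(\<Sum>r\<in>UNIV. of_real (c $ r) * (dM $ i $ r * cnj (M $ j $ r)))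
              = (\<Sum>r\<in>UNIV. \<Sum>k\<in>UNIV. H $ i $ k * cnj (M $ j $ r * N r k)) / 2"
            by (simp only: sum_divide_distrib)
          also have "\<dots> = (\<Sum>k\<in>UNIV. H $ i $ k * cnj (\<Sum>r\<in>UNIV. M $ j $ r * N r k)) / 2"
            by (subst sum.swap) (simp add: sum_distrib_left)
          also have "\<dots> = H $ i $ j / 2"
            by (simp add: N(2) if_distrib cong: if_cong)
          finally show ?thesis .
        qed
        have half': "(\<Sum>r\<in>UNIV. of_real (c $ r) * (M $ i $ r * cnj (dM $ j $ r))) = H $ i $ j / 2" for i j
        proof -
          have "(\<Sum>r\<in>UNIV. of_real (c $ r) * (M $ i $ r * cnj (dM $ j $ r)))
              = cnj (\<Sum>r\<in>UNIV. of_real (c $ r) * (dM $ j $ r * cnj (M $ i $ r)))"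
            by (simp add: mult_ac)
          also have "\<dots> = H $ i $ j / 2"
            unfolding half by (simp add: H_def cnj_hermitian_param)
          finally show ?thesis .
        qed
        have sum_halves: "(\<Sum>r\<in>UNIV. of_real (c $ r) * (M $ i $ r * cnj (dM $ j $ r)))
            + (\<Sum>r\<in>UNIV. of_real (c $ r) * (dM $ i $ r * cnj (M $ j $ r))) = H $ i $ j" for i j
          unfolding half half' by simp
        \<comment> \<open>Moving \<open>x\<close> along \<open>w *s x\<close> changes its rank-one
          matrix by the factor \<open>w + cnj w\<close>. Moving \<open>c\<close> by the same real
          multiple of itself compensates, so only the normalized entry changes, by
          \<open>w\<close>.\<close>
        have scale: "(\<Sum>r\<in>UNIV. of_real (2 * Re w * c $ r) * (M $ i $ r * cnj (M $ j $ r)))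
            = x $ i * cnj (w * x $ j) + w * x $ i * cnj (x $ j)" for i j
        proof -
          have "(\<Sum>r\<in>UNIV. of_real (2 * Re w * c $ r) * (M $ i $ r * cnj (M $ j $ r)))
              = of_real (2 * Re w) * (x $ i * cnj (x $ j))"
            unfolding eq[symmetric] by (simp add: sum_distrib_left mult_ac)
          also have "of_real (2 * Re w) = w + cnj w"
            by (simp add: complex_add_cnj)
          finally show ?thesis by (simp add: algebra_simps)
        qed
        have "F' z (dM, (2 * Re w) *\<^sub>R c, w *s x) = \<Psi> (A, w)"
          using sum_halves scale x
          by (simp add: F'_def \<Psi>_def z vec_eq_iff sum.distrib distrib_left H_def del: of_real_mult)
        then show ?thesis by (rule range_eqI[OF sym])
      qed
      then have "range \<Psi> \<subseteq> range (F' z)"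
        by (intro image_subsetI) (metis surj_pair)
      moreover have "dim (range \<Psi>) = DIM((real^'i^'i) \<times> complex)"
      proof -
        have "linear \<Psi>"
          using linear_hermitian_param by (simp add: \<Psi>_def linear_iff)
        moreover have "inj \<Psi>"
          using inj_hermitian_param by (auto simp: \<Psi>_def inj_def prod_eq_iff)
        ultimately show ?thesis
          by (simp add: dim_image_eq)
      qed
      ultimately have "CARD('i) * CARD('i) + 2 \<le> dim (range (F' z))"
        using dim_subset[of "range \<Psi>" "range (F' z)"] by simp
      moreover have "CARD('r) + 2 * CARD('i) < CARD('i) * CARD('i) + 2"
      proof -
        obtain n where "CARD('i) = Suc n"
          by (metis zero_less_card_finite gr0_conv_Suc)
        then show ?thesis
          using assms by (simp add: power2_eq_square)
      qed
      ultimately show ?thesis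
        by (simp add: mult.commute)
    qed
  qed
  then have "negligible (\<Union>i0. fst ` Z i0)"
    by (intro negligible_Union) auto
  then show ?thesis
  proof (rule negligible_subset, safe)
    fix M :: "complex^'r^'i"
    assume gp: "general_position M" and "\<not> no_further_rank_one M"
    then obtain c :: "'r \<Rightarrow> real" and x s t
      where "x \<noteq> (\<lambda>i. 0)" and st: "s \<noteq> t" "c s \<noteq> 0" "c t \<noteq> 0"
      and eq: "\<forall>i j. (\<Sum>r\<in>UNIV. of_real (c r) * (M $ i $ r * cnj (M $ j $ r))) = x i * cnj (x j)"
      unfolding no_further_rank_one_def by blast
    then obtain i0 where i0: "x i0 \<noteq> 0" by blast
    \<comment> \<open>Dividing \<open>x\<close> by \<open>x i0\<close> divides its rank-one matrix
      by the squared modulus of \<open>x i0\<close>.\<close>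
    define n where "n = (cmod (x i0))\<^sup>2"
    have n: "of_real n = x i0 * cnj (x i0)" "n \<noteq> 0"
      using i0 by (simp_all add: n_def complex_norm_square del: of_real_power)
    have "(\<Sum>r\<in>UNIV. of_real (c r / n) * (M $ i $ r * cnj (M $ j $ r))) = x i / x i0 * cnj (x j / x i0)" for i j
    proof -
      have "(\<Sum>r\<in>UNIV. of_real (c r / n) * (M $ i $ r * cnj (M $ j $ r))) = x i * cnj (x j) / of_real n"
        using eq by (simp flip: sum_divide_distrib)
      then show ?thesis by (simp add: n)
    qed
    then have "(M, (\<chi> r. c r / n), (\<chi> i. x i / x i0)) \<in> Z i0"
      using gp st i0 n by (auto simp: Z_def)
    then have "M \<in> fst ` Z i0"
      by (rule image_eqI[rotated]) simp
    then show "M \<in> (\<Union>i0. fst ` Z i0)" by blast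
  qed
qed

section \<open>Uniqueness of the decomposition\<close>

definition rank_one :: "complex^'r^'i \<Rightarrow> 'r \<Rightarrow> complex^'i^'i" where
  "rank_one M r = (\<chi> i j. M $ i $ r * cnj (M $ j $ r))"

lemma covariance_nth:
  "covariance (D, M) p $ i $ j = (\<Sum>r\<in>UNIV. D $ p $ r * rank_one M r $ i $ j)"
  by (simp add: covariance_sum rank_one_def)

lemma trivially_relatedI:
  fixes M M' :: "complex^'r::finite^'i::finite" and D D' :: "complex^'r^'p::finite"
  assumes "bij \<sigma>" and l: "\<And>r. cmod (l r) = 1"
    and M': "\<And>i r. M' $ i $ r = M $ i $ \<sigma> r * l (\<sigma> r)"
    and D': "\<And>p r. D' $ p $ r = D $ p $ \<sigma> r"
  shows "trivially_related (D, M) (D', M')"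
proof -
  define L where "L = diag_mat (\<chi> r. l r)"
  define Q :: "complex^'r^'r" where "Q = (\<chi> i j. if i = \<sigma> j then 1 else 0)"
  have multQ: "(N ** Q) $ i $ j = N $ i $ \<sigma> j" for N :: "complex^'r^'k::finite" and i j
    by (simp add: matrix_matrix_mult_def Q_def if_distrib cong: if_cong)
  have ll: "l r * cnj (l r) = 1" for r
    using complex_norm_square[of "l r"] l[of r] by simp
  have hL: "hermitian_transpose L = diag_mat (\<chi> r. cnj (l r))"
    by (auto simp: L_def hermitian_transpose_def diag_mat_def vec_eq_iff)
  have "diagonal_unitary L"
    unfolding diagonal_unitary_def hL unfolding L_def vec_eq_iff mult_diag_mat
    using ll by (auto simp: diag_mat_def mat_def mult.commute)
  moreover have "permutation_matrix Q"
    using assms(1) unfolding permutation_matrix_def Q_def by blast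
  moreover have "M' = M ** L ** Q"
    by (simp add: vec_eq_iff multQ L_def mult_diag_mat M')
  moreover have "diag_mat (D' $ p) = transpose Q ** diag_mat (D $ p) ** Q" for p
  proof -
    have "(transpose Q ** diag_mat (D $ p) ** Q) $ i $ j = transpose Q $ i $ \<sigma> j * D $ p $ \<sigma> j" for i j
      by (simp add: multQ mult_diag_mat)
    then show ?thesis
      using bij_is_inj[OF \<open>bij \<sigma>\<close>]
      by (auto simp: vec_eq_iff diag_mat_def transpose_def Q_def D' inj_eq)
  qed
  ultimately show ?thesis
    unfolding trivially_related_def by auto
qed

text \<open>Each rank-one term is Hermitian, so averaging the equation with its Hermitian transpose
  replaces the coefficients by their real parts.\<close>

lemma sum_Re_rank_one:
  assumes "\<And>i j. (\<Sum>r\<in>UNIV. d r * rank_one M r $ i $ j) = (\<Sum>s\<in>UNIV. d' s * rank_one M' s $ i $ j)"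
  shows "(\<Sum>r\<in>UNIV. Re (d r) *\<^sub>R rank_one M r) = (\<Sum>s\<in>UNIV. Re (d' s) *\<^sub>R rank_one M' s)"
proof -
  have Re: "of_real (Re z) = (z + cnj z) / 2" for z
    by (simp add: complex_add_cnj)
  have cnj: "(\<Sum>r\<in>UNIV. cnj (f r) * rank_one N r $ i $ j) = cnj (\<Sum>r\<in>UNIV. f r * rank_one N r $ j $ i)"
    for f and N :: "complex^'k::finite^'m::finite" and i j
    by (simp add: rank_one_def mult_ac)
  have *: "(\<Sum>r\<in>UNIV. of_real (Re (f r)) * rank_one N r $ i $ j) =
      ((\<Sum>r\<in>UNIV. f r * rank_one N r $ i $ j) + cnj (\<Sum>r\<in>UNIV. f r * rank_one N r $ j $ i)) / 2"
    for f and N :: "complex^'k::finite^'m::finite" and i j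
    unfolding Re cnj[symmetric] by (simp add: add_divide_distrib sum_divide_distrib sum.distrib distrib_right)
  show ?thesis
    by (simp add: vec_eq_iff scaleR_conv_of_real[where 'a = complex] * assms del: cnj_sum)
qed

text \<open>The imaginary part of \<open>z\<close> is the real part of
  \<open>- \<i> * z\<close>.\<close>

lemma sum_Im_rank_one:
  assumes "\<And>i j. (\<Sum>r\<in>UNIV. d r * rank_one M r $ i $ j) = (\<Sum>s\<in>UNIV. d' s * rank_one M' s $ i $ j)"
  shows "(\<Sum>r\<in>UNIV. Im (d r) *\<^sub>R rank_one M r) = (\<Sum>s\<in>UNIV. Im (d' s) *\<^sub>R rank_one M' s)"
proof -
  have "(\<Sum>r\<in>UNIV. (- \<i> * d r) * rank_one M r $ i $ j) = (\<Sum>s\<in>UNIV. (- \<i> * d' s) * rank_one M' s $ i $ j)" for i j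
    unfolding mult.assoc sum_distrib_left[symmetric] assms ..
  then show ?thesis
    using sum_Re_rank_one[of "\<lambda>r. - \<i> * d r" M "\<lambda>s. - \<i> * d' s" M'] by simp
qed

text \<open>
  A linear relation among the \<open>rank_one M r\<close> perturbs the trivial decomposition of one of them
  into one with at least two nonzero coefficients.
\<close>

lemma rank_one_independent:
  fixes M :: "complex^'r::finite^'i::finite"
  assumes one: "no_further_rank_one M"
    and nz: "\<And>r. \<exists>i. M $ i $ r \<noteq> 0"
    and sum: "(\<Sum>r\<in>UNIV. c r *\<^sub>R rank_one M r) = 0"
  shows "c q = 0"
proof (rule ccontr)
  assume q: "c q \<noteq> 0"
  have sum': "(\<Sum>r\<in>UNIV. of_real (c r) * (M $ i $ r * cnj (M $ j $ r))) = 0" for i j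
    using arg_cong[OF sum, of "\<lambda>X. X $ i $ j"]
    by (simp add: rank_one_def scaleR_conv_of_real[where 'a = complex])
  \<comment> \<open>The relation, scaled to have coefficient 1 at \<open>q\<close>, is added to the
    trivial decomposition. Thus \<open>c' q\<close> is 2, and every other coefficient must
    vanish.\<close>
  define c' where "c' r = (if r = q then 1 else 0) + c r / c q" for r
  have "(\<Sum>r\<in>UNIV. of_real (c' r) * (M $ i $ r * cnj (M $ j $ r))) = M $ i $ q * cnj (M $ j $ q)" for i j
  proof -
    have "of_real (c' r) * (M $ i $ r * cnj (M $ j $ r)) = (if r = q then M $ i $ r * cnj (M $ j $ r) else 0)
        + of_real (c r) * (M $ i $ r * cnj (M $ j $ r)) / of_real (c q)" for r
      by (simp add: c'_def distrib_right)
    then show ?thesis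
      using sum'[of i j] by (simp add: sum.distrib flip: sum_divide_distrib)
  qed
  moreover have "(\<lambda>i. M $ i $ q) \<noteq> (\<lambda>i. 0)"
    using nz[of q] by (auto simp: fun_eq_iff)
  moreover have "c' q \<noteq> 0"
    using q by (simp add: c'_def)
  ultimately have *: "c' t \<noteq> 0 \<Longrightarrow> q = t" for t
    using one unfolding no_further_rank_one_def by blast
  then have "c t = 0" if "t \<noteq> q" for t
  proof -
    have "c' t = 0" using * that by blast
    then show ?thesis using that q by (simp add: c'_def)
  qed
  then have *: "(\<Sum>r\<in>UNIV. of_real (c r) * (M $ i $ r * cnj (M $ j $ r)))
      = of_real (c q) * (M $ i $ q * cnj (M $ j $ q))" for i j
    by (simp add: sum.remove[of UNIV q])
  obtain i where "M $ i $ q \<noteq> 0" using nz by blast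
  with *[of i i] sum'[of i i] q show False by simp
qed

text \<open>Let \<open>z\<close> be the part of \<open>rank_one M r\<close> orthogonal to the other
  span. Pairing the system with \<open>z\<close> gives a real relation among the columns of
  \<open>D\<close>, so \<open>z\<close> is orthogonal to every term of \<open>M\<close>, in
  particular to the one it came from.\<close>

lemma rank_one_in_span:
  fixes M M' :: "complex^'r::finite^'i::finite" and D D' :: "complex^'r^'p::finite"
  assumes D: "real_independent_columns D"
    and eq: "covariance (D, M) = covariance (D', M')"
  shows "rank_one M r \<in> span (range (rank_one M'))"
proof -
  have eq': "(\<Sum>r\<in>UNIV. D $ p $ r * rank_one M r $ i $ j) = (\<Sum>s\<in>UNIV. D' $ p $ s * rank_one M' s $ i $ j)" for p i j
    using covariance_nth[of D M p i j] covariance_nth[of D' M' p i j] eq by simp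
  obtain y z where y: "y \<in> span (range (rank_one M'))"
    and z: "\<And>w. w \<in> span (range (rank_one M')) \<Longrightarrow> orthogonal z w"
    and yz: "rank_one M r = y + z"
    using orthogonal_subspace_decomp_exists by blast
  have z': "z \<bullet> rank_one M' s = 0" for s
    using z[of "rank_one M' s"] by (simp add: span_base orthogonal_def)
  have "(\<Sum>r\<in>UNIV. of_real (z \<bullet> rank_one M r) * D $ p $ r) = 0" for p
  proof -
    have "(\<Sum>r\<in>UNIV. Re (D $ p $ r) * (z \<bullet> rank_one M r)) = z \<bullet> (\<Sum>s\<in>UNIV. Re (D' $ p $ s) *\<^sub>R rank_one M' s)"
      unfolding sum_Re_rank_one[OF eq', symmetric] by (simp add: inner_sum_right)
    also have "\<dots> = 0" by (simp add: inner_sum_right z')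
    finally have "(\<Sum>r\<in>UNIV. Re (D $ p $ r) * (z \<bullet> rank_one M r)) = 0" .
    moreover have "(\<Sum>r\<in>UNIV. Im (D $ p $ r) * (z \<bullet> rank_one M r)) = z \<bullet> (\<Sum>s\<in>UNIV. Im (D' $ p $ s) *\<^sub>R rank_one M' s)"
      unfolding sum_Im_rank_one[OF eq', symmetric] by (simp add: inner_sum_right)
    then have "(\<Sum>r\<in>UNIV. Im (D $ p $ r) * (z \<bullet> rank_one M r)) = 0"
      by (simp add: inner_sum_right z')
    ultimately show ?thesis
      by (simp add: complex_eq_iff mult.commute)
  qed
  then have "z \<bullet> rank_one M r = 0"
    using D[unfolded real_independent_columns_def, rule_format, of "\<lambda>r. z \<bullet> rank_one M r"] by blast
  then have "z = 0"
    using z[OF y] by (simp add: yz inner_add_right orthogonal_def)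
  with y yz show ?thesis by simp
qed

text \<open>Column \<open>i0\<close> of the matrix equation gives the factor, because the entry of
  \<open>M'\<close> there can be cancelled.\<close>

lemma rank_one_multiple:
  assumes "rank_one M' s = k *\<^sub>R rank_one M r" and "M' $ i0 $ s \<noteq> 0"
  obtains \<kappa> where "\<kappa> \<noteq> 0" "\<And>i. M' $ i $ s = \<kappa> * M $ i $ r"
proof -
  have eq: "M' $ i $ s * cnj (M' $ j $ s) = of_real k * (M $ i $ r * cnj (M $ j $ r))" for i j
    using arg_cong[OF assms(1), of "\<lambda>X. X $ i $ j"]
    by (simp add: rank_one_def scaleR_conv_of_real[where 'a = complex])
  define \<kappa> where "\<kappa> = of_real k * cnj (M $ i0 $ r) / cnj (M' $ i0 $ s)"
  have "M' $ i $ s = \<kappa> * M $ i $ r" for i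
    using eq[of i i0] assms(2) by (simp add: \<kappa>_def field_simps)
  moreover from this have "\<kappa> \<noteq> 0" using assms(2) by auto
  ultimately show ?thesis using that by blast
qed

text \<open>Any solution has terms with the same real span, so each of its columns is a multiple of
  a column of \<open>M\<close>. Dimension makes the assignment \<sigma> a permutation, independence
  matches \<open>D\<close>, and the moduli of the factors are absorbed by
  \<open>rescale\<close>.\<close>

lemma unique_solution_covariance:
  fixes M :: "complex^'r::finite^'i::finite" and D :: "complex^'r^'p::finite"
  assumes one: "no_further_rank_one M"
    and nz: "\<And>r. \<exists>i. M $ i $ r \<noteq> 0"
    and D: "real_independent_columns D"
  shows "unique_solution TYPE('r) (covariance (D, M))"
proof -
  have indep: "c q = 0" if "(\<Sum>r\<in>UNIV. c r *\<^sub>R rank_one M r) = 0" for c q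
    using one nz that by (rule rank_one_independent)
  have inj: "inj (rank_one M)"
  proof (rule injI, rule ccontr)
    fix q t assume qt: "rank_one M q = rank_one M t" "q \<noteq> t"
    define c :: "'r \<Rightarrow> real" where "c r = (if r = q then 1 else 0) - (if r = t then 1 else 0)" for r
    have "(\<Sum>r\<in>UNIV. c r *\<^sub>R rank_one M r) = rank_one M q - rank_one M t"
      by (simp add: c_def scaleR_left_diff_distrib sum_subtractf if_distrib[of "\<lambda>c. c *\<^sub>R _"] cong: if_cong)
    then have "c q = 0" using qt(1) by (intro indep) simp
    then show False using qt(2) by (simp add: c_def)
  qed
  have independent: "independent (range (rank_one M))"
  proof
    assume "dependent (range (rank_one M))"
    then obtain u v where u: "v \<in> range (rank_one M)" "u v \<noteq> 0"
      "(\<Sum>v\<in>range (rank_one M). u v *\<^sub>R v) = 0"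
      by (auto simp: dependent_finite)
    then have "(\<Sum>r\<in>UNIV. u (rank_one M r) *\<^sub>R rank_one M r) = 0"
      by (simp add: sum.reindex[OF inj])
    from indep[OF this] u show False by auto
  qed
  have dim: "dim (range (rank_one M)) = CARD('r)"
    using dim_eq_card_independent[OF independent] card_image[OF inj] by simp
  have "\<exists>\<delta>. (\<forall>r. \<delta> $ r > 0) \<and> trivially_related (D, M) (rescale \<delta> (D', M'))"
    if eq: "covariance (D, M) = covariance (D', M')" for D' :: "complex^'r^'p" and M' :: "complex^'r^'i"
  proof -
    have sub: "range (rank_one M) \<subseteq> span (range (rank_one M'))"
      using rank_one_in_span[OF D eq] by blast
    have "dim (span (range (rank_one M'))) \<le> CARD('r)"
      using dim_le_card'[of "range (rank_one M')"] card_image_le[of UNIV "rank_one M'"] by simp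
    then have span: "span (range (rank_one M)) = span (range (rank_one M'))"
      using dim_eq_span[OF sub] dim by simp
    \<comment> \<open>A zero column would leave at most R - 1 generators for a space of dimension
      R.\<close>
    have nz': "\<exists>i. M' $ i $ s \<noteq> 0" for s
    proof (rule ccontr)
      assume "\<not> ?thesis"
      then have "rank_one M' s = 0" by (simp add: rank_one_def vec_eq_iff)
      then have "rank_one M' r \<in> span (rank_one M' ` (UNIV - {s}))" for r
        by (cases "r = s") (auto intro!: span_base simp: span_zero)
      then have "span (range (rank_one M')) \<subseteq> span (rank_one M' ` (UNIV - {s}))"
        by (intro span_minimal) auto
      then have "range (rank_one M) \<subseteq> span (rank_one M' ` (UNIV - {s}))"
        using sub by (rule order_trans[rotated])
      then have "CARD('r) \<le> card (rank_one M' ` (UNIV - {s}))"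
        using dim dim_le_card[of "range (rank_one M)"] by simp
      also have "\<dots> \<le> card (UNIV - {s})" by (rule card_image_le) simp
      also have "\<dots> < CARD('r)" by (rule psubset_card_mono) auto
      finally show False by simp
    qed
    have "\<exists>r \<kappa>. \<kappa> \<noteq> 0 \<and> (\<forall>i. M' $ i $ s = \<kappa> * M $ i $ r)" for s
    proof -
      have "rank_one M' s \<in> span (range (rank_one M))"
        unfolding span by (simp add: span_base)
      then obtain u where "rank_one M' s = (\<Sum>v\<in>range (rank_one M). u v *\<^sub>R v)"
        by (auto simp: span_finite)
      then have u: "rank_one M' s = (\<Sum>r\<in>UNIV. u (rank_one M r) *\<^sub>R rank_one M r)"
        by (simp add: sum.reindex[OF inj])
      obtain i0 where i0: "M' $ i0 $ s \<noteq> 0" using nz' by blast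
      have "rank_one M' s $ i0 $ i0 \<noteq> 0"
        using i0 by (simp add: rank_one_def)
      then have "\<exists>r. u (rank_one M r) \<noteq> 0"
        unfolding u by (rule contrapos_np) simp
      then obtain r where r: "u (rank_one M r) \<noteq> 0" ..
      have "M' $ i $ s * cnj (M' $ j $ s)
          = (\<Sum>r\<in>UNIV. of_real (u (rank_one M r)) * (M $ i $ r * cnj (M $ j $ r)))" for i j
        using arg_cong[OF u, of "\<lambda>X. X $ i $ j"]
        by (simp add: rank_one_def scaleR_conv_of_real[where 'a = complex])
      then have "u (rank_one M t) = 0" if "t \<noteq> r" for t
        using one[unfolded no_further_rank_one_def, rule_format,
            of "\<lambda>i. M' $ i $ s" "\<lambda>r. u (rank_one M r)" t r] i0 r that by (auto simp: fun_eq_iff)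
      then have "rank_one M' s = u (rank_one M r) *\<^sub>R rank_one M r"
        unfolding u by (simp add: sum.remove[of UNIV r])
      then show ?thesis
        using i0 by (metis rank_one_multiple)
    qed
    then obtain \<sigma> \<kappa> where \<kappa>: "\<And>s. \<kappa> s \<noteq> 0" and M': "\<And>s i. M' $ i $ s = \<kappa> s * M $ i $ \<sigma> s"
      by metis
    have X': "rank_one M' s = (cmod (\<kappa> s))\<^sup>2 *\<^sub>R rank_one M (\<sigma> s)" for s
      by (simp add: rank_one_def vec_eq_iff M' scaleR_conv_of_real[where 'a = complex]
          complex_norm_square mult_ac del: of_real_power)
    have "r0 \<in> range \<sigma>" for r0
    proof (rule ccontr)
      \<comment> \<open>If \<sigma> missed \<open>r0\<close>, every term of \<open>M'\<close> would
        lie in the span of the other terms of \<open>M\<close>, and so would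
        \<open>rank_one M r0\<close>.\<close>
      assume "r0 \<notin> range \<sigma>"
      then have "rank_one M (\<sigma> s) \<in> range (rank_one M) - {rank_one M r0}" for s
        using inj by (auto simp: inj_eq)
      then have "rank_one M' s \<in> span (range (rank_one M) - {rank_one M r0})" for s
        unfolding X' by (intro span_scale span_base)
      then have "span (range (rank_one M')) \<subseteq> span (range (rank_one M) - {rank_one M r0})"
        by (intro span_minimal) auto
      then have "rank_one M r0 \<in> span (range (rank_one M) - {rank_one M r0})"
        using sub by blast
      then show False
        using independent unfolding dependent_def by blast
    qed
    then have "surj \<sigma>" by blast
    then have bij: "bij \<sigma>" by (simp add: bij_def finite_UNIV_surj_inj)
    define \<tau> where "\<tau> = inv \<sigma>"
    have \<tau>: "\<tau> (\<sigma> s) = s" "\<sigma> (\<tau> r) = r" for s r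
      using bij by (simp_all add: \<tau>_def bij_is_inj bij_is_surj surj_f_inv_f)
    have D': "D $ p $ \<sigma> s = D' $ p $ s * of_real ((cmod (\<kappa> s))\<^sup>2)" for p s
    proof -
      \<comment> \<open>The difference of the coefficients of \<open>rank_one M r\<close> in the two
        expansions. Independence holds over the reals, so real and imaginary parts are treated
        separately.\<close>
      define d where "d r = D $ p $ r - D' $ p $ \<tau> r * of_real ((cmod (\<kappa> (\<tau> r)))\<^sup>2)" for r
      have "(\<Sum>r\<in>UNIV. d r * rank_one M r $ i $ j) = (\<Sum>r\<in>UNIV. 0 * rank_one M r $ i $ j)" for i j
      proof -
        have "(\<Sum>r\<in>UNIV. D $ p $ r * rank_one M r $ i $ j) = (\<Sum>s\<in>UNIV. D' $ p $ s * rank_one M' s $ i $ j)"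
          using covariance_nth[of D M p i j] covariance_nth[of D' M' p i j] eq by simp
        also have "\<dots> = (\<Sum>s\<in>UNIV. D' $ p $ \<tau> (\<sigma> s) * of_real ((cmod (\<kappa> (\<tau> (\<sigma> s))))\<^sup>2) * rank_one M (\<sigma> s) $ i $ j)"
          by (simp add: X' \<tau> scaleR_conv_of_real[where 'a = complex] mult_ac)
        also have "\<dots> = (\<Sum>r\<in>UNIV. D' $ p $ \<tau> r * of_real ((cmod (\<kappa> (\<tau> r)))\<^sup>2) * rank_one M r $ i $ j)"
          by (rule sum.reindex_bij_betw[OF bij])
        finally show ?thesis by (simp add: d_def left_diff_distrib sum_subtractf)
      qed
      from sum_Re_rank_one[OF this] sum_Im_rank_one[OF this]
      have "Re (d r) = 0" "Im (d r) = 0" for r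
        using indep[of "\<lambda>r. Re (d r)"] indep[of "\<lambda>r. Im (d r)"] by simp_all
      then have "d (\<sigma> s) = 0" by (simp add: complex_eq_iff)
      then show ?thesis by (simp add: d_def \<tau>)
    qed
    \<comment> \<open>This scale removes the modulus of each factor and leaves the phase
      \<open>sgn (\<kappa> s)\<close>. The phases are indexed by columns of \<open>M\<close>, hence
      the inverse permutation \<tau>.\<close>
    define \<delta> where "\<delta> = (\<chi> s. 1 / cmod (\<kappa> s))"
    have "trivially_related (D, M) (rescale \<delta> (D', M'))"
      unfolding rescale_def prod.case
    proof (rule trivially_relatedI[OF bij])
      show "cmod (sgn (\<kappa> (\<tau> r))) = 1" for r
        using \<kappa> by (simp add: norm_sgn)
      show "(M' ** diag_mat (\<chi> r. of_real (\<delta> $ r))) $ i $ r = M $ i $ \<sigma> r * sgn (\<kappa> (\<tau> (\<sigma> r)))" for i r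
        by (simp add: mult_diag_mat \<delta>_def M' \<tau> sgn_eq)
      show "(\<chi> p r. D' $ p $ r / of_real ((\<delta> $ r)\<^sup>2)) $ p $ r = D $ p $ \<sigma> r" for p r
        by (simp add: D' \<delta>_def power_divide)
    qed
    moreover have "\<delta> $ r > 0" for r
      using \<kappa> by (simp add: \<delta>_def)
    ultimately show ?thesis by blast
  qed
  then show ?thesis
    unfolding unique_solution_def solves_def
    by (intro exI[of _ "(D, M)"]) (auto simp: fun_eq_iff)
qed

section \<open>Uniqueness outside a null set of parameters\<close>

theorem theorem2:
  fixes \<tau> :: "'p::finite \<Rightarrow> real"
    and \<mu> :: "('p, 'r::finite, 'i::finite) unknowns measure"
  assumes lags: "\<And>p. \<tau> p \<noteq> 0"
    and R_le: "CARD('r) \<le> min (2 * CARD('p)) ((CARD('i) - 1)\<^sup>2)"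
    and \<mu>_sets: "sets \<mu> = sets lebesgue"
    and \<mu>_ac: "absolutely_continuous lebesgue \<mu>"
  shows "{(D, M). \<not> unique_solution TYPE('r) (covariance (D, M))} \<in> null_sets \<mu>"
proof -
  define B\<^sub>D where "B\<^sub>D = {D :: complex^'r^'p. \<not> real_independent_columns D}"
  define B\<^sub>M where "B\<^sub>M = {M :: complex^'r^'i. \<not> general_position M}
    \<union> {M. general_position M \<and> \<not> no_further_rank_one M}"
  have "negligible B\<^sub>D"
    unfolding B\<^sub>D_def using R_le by (intro negligible_not_real_independent_columns) simp
  moreover have "negligible B\<^sub>M"
    unfolding B\<^sub>M_def using R_le
    by (intro negligible_Un negligible_not_general_position negligible_further_rank_one) simp
  ultimately have "negligible (B\<^sub>D \<times> UNIV \<union> UNIV \<times> B\<^sub>M)"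
    by (intro negligible_Un negligible_Times_UNIV negligible_UNIV_Times)
  moreover have "unique_solution TYPE('r) (covariance (D, M))" if "D \<notin> B\<^sub>D" "M \<notin> B\<^sub>M" for D M
  proof (rule unique_solution_covariance)
    show "real_independent_columns D" "no_further_rank_one M"
      using that by (auto simp: B\<^sub>D_def B\<^sub>M_def)
    have gp: "general_position M"
      using that by (auto simp: B\<^sub>M_def)
    show "\<exists>i. M $ i $ r \<noteq> 0" for r
    proof (rule ccontr)
      \<comment> \<open>A zero column would be a dependent family with one member, and 1 is at most
        \<open>CARD('i)\<close>.\<close>
      assume "\<nexists>i. M $ i $ r \<noteq> 0"
      then show False
        using general_position_independent[OF gp, of "{r}" "\<lambda>_. 1" r] by (simp add: Suc_leI)
    qed
  qed
  then have "{(D, M). \<not> unique_solution TYPE('r) (covariance (D, M))} \<subseteq> B\<^sub>D \<times> UNIV \<union> UNIV \<times> B\<^sub>M"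
    by blast
  ultimately have "negligible {(D :: complex^'r^'p, M :: complex^'r^'i).
      \<not> unique_solution TYPE('r) (covariance (D, M))}"
    by (rule negligible_subset)
  then show ?thesis
    using \<mu>_ac unfolding negligible_iff_null_sets absolutely_continuous_def by blast
qed

end
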